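(* Let $V:\mathbb{R}\to\mathbb{R}$ be in $L^1_{\mathrm{loc}}(\mathbb{R})$ with $$C_1 = \sup_{x\in\mathbb{R}} \int_x^{x+1} V_-(y)\,dy < \infty ,$$ let $E\in\mathbb{C}$, and let $u:\mathbb{R}\to\mathbb{C}$ be a solution of $-u''(x)+V(x)u(x)=Eu(x)$. Put $C_2 = C_1+|E|$. For parts (i)–(v) assume $C_2>0$ and set $$C = C_2+2\sqrt{C_2},\qquad K = \frac{1}{\sqrt{C_2}},\qquad \delta = -\frac12+\sqrt{\frac14+\frac{1}{2C_2}} .$$ Then the following hold. (i) For every $x\in\mathbb{R}$, $$|u'(x)| \le C \max_{y\in[x-K,x+K]} |u(y)| .$$ (ii) If $x\in\mathbb{R}$ satisfies $u(x)\neq 0$ and $\operatorname{Re}[\overline{u(x)}\,u'(x)]\ge 0$, then $$|u(y)| > \frac{|u(x)|}{2}\quad\text{for all } y\in[x,x+\delta).$$ (iii) For every $1\le p<\infty$ and every $x\in\mathbb{R}$, $$|u(x)|^p \le \frac{2^p}{\delta}\int_{x-\delta}^{x+\delta}|u(y)|^p\,dy .$$ (iv) For every $1\le p<\infty$ and every $x\in\mathbb{R}$, $$|u'(x)|^p \le \frac{2^pC^p}{\delta}\int_{x-K-\delta}^{x+K+\delta}|u(y)|^p\,dy .$$ (v) Let $1\le p\le\infty$ and let $w:\mathbb{R}\to(0,\infty)$ be a measurable function with $$\sup_{\substack{x,y\in\mathbb{R}\\ |x-y|\le K+\delta}} \frac{w(x)}{w(y)}<\infty .$$ Then $u\in L^p(w(x)\,dx)$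 implies $u'\in L^p(w(x)\,dx)$. (vi) If $u\in L^p(\mathbb{R},dx)$ for some $1\le p<\infty$, then $$\lim_{x\to\pm\infty}u(x)=\lim_{x\to\pm\infty}u'(x)=0 .$$
   Context: $V_-=\max(-V,0)\ge 0$ denotes the negative part of $V$. A solution of $-u''+Vu=Eu$ means a function $u:\mathbb{R}\to\mathbb{C}$ such that $u$ and $u'$ are absolutely continuous on every compact interval and the equation holds for Lebesgue-almost every $x\in\mathbb{R}$. $L^p(w(x)\,dx)$ is the usual $L^p$ space on $\mathbb{R}$ with respect to the measure $w(x)\,dx$. *)

theory Defs
  imports "HOL-Analysis.Analysis"
begin

definition locally_integrable :: "(real \<Rightarrow> real) \<Rightarrow> bool" where
  "locally_integrable V \<longleftrightarrow> (\<forall>S. compact S \<longrightarrow> V absolutely_integrable_on S)"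

text \<open>
  Absolute continuity of a function (the library's \<open>absolutely_continuous\<close> concerns measures).
  A division \<open>D\<close> of \<open>T\<close> is a finite family of compact intervals with pairwise disjoint interiors
  and union \<open>T\<close>; here \<open>T\<close> is an arbitrary, not necessarily connected, subset of the domain, so \<open>D\<close>
  ranges over all finite families of non-overlapping compact subintervals.
\<close>
definition absolutely_continuous_on :: "real set \<Rightarrow> (real \<Rightarrow> 'a::real_normed_vector) \<Rightarrow> bool" where
  "absolutely_continuous_on S f \<longleftrightarrow>
     (\<forall>\<epsilon>>0. \<exists>\<eta>>0. \<forall>D T. D division_of T \<and> T \<subseteq> S \<and> (\<Sum>k\<in>D. Sup k - Inf k) < \<eta> \<longrightarrow>
        (\<Sum>k\<in>D. norm (f (Sup k) - f (Inf k))) < \<epsilon>)"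

abbreviation vderiv :: "(real \<Rightarrow> 'a::real_normed_vector) \<Rightarrow> real \<Rightarrow> 'a" where
  "vderiv f \<equiv> (\<lambda>x. vector_derivative f (at x))"

text \<open>
  Since \<open>vector_derivative\<close> is a total function, the existence of the first derivative (everywhere)
  and of the second derivative (almost everywhere) is required explicitly.
\<close>
definition schrodinger_solution :: "(real \<Rightarrow> real) \<Rightarrow> complex \<Rightarrow> (real \<Rightarrow> complex) \<Rightarrow> bool" where
  "schrodinger_solution V E u \<longleftrightarrow>
     (\<forall>x. u differentiable (at x)) \<and>
     (\<forall>a b. absolutely_continuous_on {a..b} u) \<and>
     (\<forall>a b. absolutely_continuous_on {a..b} (vderiv u)) \<and>
     (AE x in lebesgue. vderiv u differentiable (at x) \<and>
        - vderiv (vderiv u) x + complex_of_real (V x) * u x = E * u x)"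

text \<open>Membership of a function (not an equivalence class) in \<open>L\<^sup>p(M)\<close> for \<open>1 \<le> p \<le> \<infinity>\<close>.\<close>
definition Lp_space :: "ennreal \<Rightarrow> 'a measure \<Rightarrow> ('a \<Rightarrow> 'b::real_normed_vector) set" where
  "Lp_space p M = {f \<in> borel_measurable M.
     if p = \<infinity> then (\<exists>B. AE x in M. norm (f x) \<le> B)
     else integrable M (\<lambda>x. norm (f x) powr enn2real p)}"

end

(*
For a unimodular w put f = Re (w u). While f >= 0 and |u| <= M, the equation gives
f'' >= -(V_- + |E|) M, and the integral of V_- + |E| over an interval of length l is at most
C_2 (1 + l); so f' can drop only slowly. If |u'(x)| were larger than C M, then choosing the phase
of u'(x), f would increase by more than M on [x, x + K] or on [x - K, x] (whichever side keeps
f >= 0), which gives (i). With the phase of u at a maximum of |u|, the same bound shows that |u|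
cannot halve within distance delta, because C_2 delta (1 + delta) = 1/2; this is (ii), and (iii),
(iv) follow by integration on the side where Re (cnj u u') has the right sign. Integrating (iv)
against w gives (v), and the tails of the integrals in (iii), (iv) give (vi).
*)
theory Submission
  imports Defs
begin

section \<open>Absolute continuity and the fundamental theorem of calculus\<close>

text \<open>Two members of a division meet in a convex set with empty interior, hence in a null set,
  so measure is additive over them. This turns the length condition in
  \<open>absolutely_continuous_on\<close> into a measure condition, which an open cover of a null
  set can meet.\<close>

lemma sum_length_division:
  fixes D :: "real set set"
  assumes "D division_of T"
  shows "(\<Sum>k\<in>D. Sup k - Inf k) = measure lebesgue T"
proof -
  note d = division_ofD[OF assms]
  have "measure lebesgue (\<Union>D) = (\<Sum>k\<in>D. measure lebesgue k)"
  proof (rule measure_negligible_finite_Union)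
    show "pairwise (\<lambda>S T. negligible (S \<inter> T)) D"
    proof (rule pairwiseI)
      fix k l assume kl: "k \<in> D" "l \<in> D" "k \<noteq> l"
      then obtain a b c e where "k = cbox a b" "l = cbox c e"
        using d(4) by metis
      then have "convex (k \<inter> l)" "interior (k \<inter> l) = {}"
        using d(5)[OF kl] by (simp_all add: convex_Int)
      then show "negligible (k \<inter> l)"
        using negligible_convex_interior by blast
    qed
  qed (use d(1,4) in \<open>auto dest!: d(4)\<close>)
  also have "\<dots> = (\<Sum>k\<in>D. Sup k - Inf k)"
  proof (rule sum.cong)
    fix k assume "k \<in> D"
    then obtain a b where "k = {a..b}" "a \<le> b"
      using d(3,4) by (metis atLeastatMost_empty_iff box_real(2))
    then show "measure lebesgue k = Sup k - Inf k" by simp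
  qed simp
  finally show ?thesis using d(6) by simp
qed

text \<open>
  A gauge proof: off \<open>N\<close> the gauge is the one from differentiability; on \<open>N\<close> it confines the tagged
  intervals to an open set of small measure, where absolute continuity controls the increments of \<open>g\<close>.
\<close>
lemma absolutely_continuous_on_has_integral:
  fixes g g' :: "real \<Rightarrow> 'a::real_normed_vector"
  assumes ac: "absolutely_continuous_on {a..b} g" and "a \<le> b" and "negligible N"
    and deriv: "\<And>x. x \<in> {a..b} - N \<Longrightarrow> (g has_vector_derivative g' x) (at x within {a..b})"
  shows "(g' has_integral g b - g a) {a..b}"
proof -
  \<comment> \<open>With the integrand zeroed on \<open>N\<close>, a tag in \<open>N\<close>
    contributes only an increment of \<open>g\<close> to the error of the Riemann sum.\<close>
  define h where "h x = (if x \<in> N then 0 else g' x)" for x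
  have "(h has_integral g b - g a) (cbox a b)"
    unfolding has_integral
  proof (intro allI impI)
    fix e :: real assume "e > 0"
    \<comment> \<open>Tags outside \<open>N\<close> cost at most \<open>e' * (b - a)\<close>, which
      is at most \<open>e / 2\<close>; the summand 1 keeps the denominator positive when
      \<open>a = b\<close>.\<close>
    define e' where "e' = e / (2 * (b - a + 1))"
    have "e' > 0" using \<open>e > 0\<close> \<open>a \<le> b\<close> by (simp add: e'_def)
    have "\<exists>d>0. x \<in> {a..b} - N \<longrightarrow>
         (\<forall>y\<in>{a..b}. norm (y - x) < d \<longrightarrow> norm (g y - g x - (y - x) *\<^sub>R g' x) \<le> e' * norm (y - x))" for x
      using deriv[unfolded has_vector_derivative_def has_derivative_within_alt] \<open>e' > 0\<close>
      by (cases "x \<in> {a..b} - N") (blast, auto intro: exI[of _ 1])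
    then obtain d where d: "\<And>x. 0 < d x"
      "\<And>x y. \<lbrakk>x \<in> {a..b} - N; y \<in> {a..b}; norm (y - x) < d x\<rbrakk>
        \<Longrightarrow> norm (g y - g x - (y - x) *\<^sub>R g' x) \<le> e' * norm (y - x)"
      by metis
    obtain \<eta> where \<eta>: "\<eta> > 0" "\<And>D T. \<lbrakk>D division_of T; T \<subseteq> {a..b}; (\<Sum>k\<in>D. Sup k - Inf k) < \<eta>\<rbrakk>
        \<Longrightarrow> (\<Sum>k\<in>D. norm (g (Sup k) - g (Inf k))) < e / 2"
      using ac \<open>e > 0\<close> unfolding absolutely_continuous_on_def by (meson half_gt_zero)
    have null: "N \<in> null_sets lebesgue"
      using \<open>negligible N\<close> by (simp add: negligible_iff_null_sets)
    then obtain U where U: "open U" "N \<subseteq> U" "U - N \<in> lmeasurable" "emeasure lebesgue (U - N) < ennreal \<eta>"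
      using sets_lebesgue_outer_open[OF _ \<eta>(1)] by (metis null_setsD2)
    \<comment> \<open>Outer regularity bounds only \<open>U - N\<close>; since \<open>N\<close> is
      null, the bound carries over to \<open>U\<close>.\<close>
    have "U \<in> lmeasurable"
      using fmeasurable.Un[OF U(3) negligible_imp_measurable[OF \<open>negligible N\<close>]] U(2)
      by (simp add: Un_absorb2)
    moreover have "emeasure lebesgue U < ennreal \<eta>"
      using U(4) emeasure_Diff_null_set[OF null, of U] \<open>U \<in> lmeasurable\<close> by (auto dest: fmeasurableD)
    ultimately have mU: "measure lebesgue U < \<eta>"
      using \<eta>(1) by (simp add: emeasure_eq_measure2 ennreal_less_iff)
    define \<gamma> where "\<gamma> x = (if x \<in> N then U else ball x (d x))" for x
    show "\<exists>\<gamma>. gauge \<gamma> \<and> (\<forall>p. p tagged_division_of (cbox a b) \<and> \<gamma> fine p \<longrightarrow>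
           norm ((\<Sum>(x,k)\<in>p. measure lborel k *\<^sub>R h x) - (g b - g a)) < e)"
    proof (intro exI conjI allI impI)
      show "gauge \<gamma>" using U d(1) by (auto simp: gauge_def \<gamma>_def)
      fix p assume "p tagged_division_of (cbox a b) \<and> \<gamma> fine p"
      then have p: "p tagged_division_of (cbox a b)" and fine: "\<gamma> fine p" by auto
      note tp = tagged_division_ofD[OF p]
      have fp: "finite p" using tp(1) .
      have interval: "\<exists>u v. k = {u..v} \<and> u \<le> x \<and> x \<le> v \<and> a \<le> u \<and> v \<le> b" if "(x, k) \<in> p" for x k
        using tp(2,3,4)[OF that] by (metis atLeastAtMost_iff atLeastatMost_subset_iff box_real(2) order_trans)
      have len: "(\<Sum>(x,K)\<in>p. Sup K - Inf K) = b - a" and gdiff: "(\<Sum>(x,K)\<in>p. g (Sup K) - g (Inf K)) = g b - g a"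
        using additive_tagged_division_1[where f= "\<lambda>x. x"] additive_tagged_division_1[where f= g]
          \<open>a \<le> b\<close> p by auto
      define pN where "pN = {z\<in>p. fst z \<in> N}"
      have sub: "pN \<subseteq> p" by (auto simp: pN_def)
      let ?err = "\<lambda>(x, k). measure lborel k *\<^sub>R h x - (g (Sup k) - g (Inf k))"
      have regular: "norm (?err z) \<le> e' * (case z of (x, k) \<Rightarrow> Sup k - Inf k)" if "z \<in> p - pN" for z
      proof -
        obtain x k where z: "z = (x, k)" by force
        with that have xk: "(x, k) \<in> p" "x \<notin> N" by (auto simp: pN_def)
        obtain u v where uv: "k = {u..v}" "u \<le> x" "x \<le> v" "a \<le> u" "v \<le> b" using interval[OF xk(1)] by blast
        have "k \<subseteq> \<gamma> x" using fine xk(1) by (auto simp: fine_def)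
        then have "k \<subseteq> ball x (d x)" using xk(2) by (simp add: \<gamma>_def)
        then have "u \<in> ball x (d x)" "v \<in> ball x (d x)"
          using uv(2,3) unfolding uv(1) by (meson atLeastAtMost_iff order_refl order_trans subsetD)+
        then have "norm (u - x) < d x" "norm (v - x) < d x"
          by (simp_all add: dist_real_def abs_minus_commute)
        then have gu: "norm (g u - g x - (u - x) *\<^sub>R g' x) \<le> e' * norm (u - x)"
           and gv: "norm (g v - g x - (v - x) *\<^sub>R g' x) \<le> e' * norm (v - x)"
          using uv xk(2) by (intro d(2); simp)+
        \<comment> \<open>Both endpoints are compared with the tag, which lies between them, so the
          two errors add up to \<open>e'\<close> times the length of the interval.\<close>
        have split: "(v - u) *\<^sub>R g' x - (g v - g u)
            = (g u - g x - (u - x) *\<^sub>R g' x) - (g v - g x - (v - x) *\<^sub>R g' x)"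
          by (simp add: algebra_simps)
        have "norm ((v - u) *\<^sub>R g' x - (g v - g u)) \<le> e' * norm (u - x) + e' * norm (v - x)"
          unfolding split by (rule order_trans[OF norm_triangle_ineq4 add_mono[OF gu gv]])
        also have "\<dots> = e' * (v - u)" using uv by (simp add: algebra_simps)
        finally show ?thesis using uv xk(2) by (simp add: z h_def)
      qed
      have division: "snd ` pN division_of \<Union>(snd ` pN)"
        using division_of_subset[of "snd ` p" "snd ` pN"] division_of_tagged_division[OF p] sub
        by (metis division_ofD(6) image_mono)
      have "\<Union>(snd ` pN) \<subseteq> U"
        using fine by (force simp: pN_def fine_def \<gamma>_def)
      then have "(\<Sum>k\<in>snd ` pN. Sup k - Inf k) < \<eta>"
        unfolding sum_length_division[OF division]
        using mU \<open>U \<in> lmeasurable\<close> division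
        by (meson le_less_trans lmeasurable_division measure_mono_fmeasurable fmeasurableD)
      moreover have "\<Union>(snd ` pN) \<subseteq> {a..b}"
        using tp(3) sub by fastforce
      ultimately have small: "(\<Sum>k\<in>snd ` pN. norm (g (Sup k) - g (Inf k))) < e / 2"
        using \<eta>(2) division by blast
      have tN: "pN tagged_division_of \<Union>(snd ` pN)"
        using tagged_partial_division_of_Union_self[of pN] p sub
        by (metis tagged_division_of_def tagged_partial_division_subset)
      have singular: "(\<Sum>z\<in>pN. norm (?err z)) < e / 2"
      proof -
        \<comment> \<open>Passing from tagged pairs to intervals needs a function that vanishes on
          degenerate boxes, because different tags may share such a box. \<open>Sup\<close> and
          \<open>Inf\<close> of the empty set carry no information, hence the default 0.\<close>
        let ?d = "\<lambda>k. if k = {} then 0 else norm (g (Sup k) - g (Inf k))"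
        have nonempty: "k \<noteq> {}" if "(x, k) \<in> pN" for x k
          using interval that sub by fastforce
        have "(\<Sum>z\<in>pN. norm (?err z)) = (\<Sum>(x, k)\<in>pN. ?d k)"
          by (rule sum.cong) (use nonempty in \<open>auto simp: pN_def h_def norm_minus_commute\<close>)
        also have "\<dots> = (\<Sum>k\<in>snd ` pN. ?d k)"
        proof (rule sum.over_tagged_division_lemma[OF tN])
          fix u v :: real assume "box u v = {}"
          then have "v \<le> u" by simp
          then show "?d (cbox u v) = 0"
            by (cases "u = v") auto
        qed
        also have "\<dots> = (\<Sum>k\<in>snd ` pN. norm (g (Sup k) - g (Inf k)))"
          by (rule sum.cong) (use nonempty in auto)
        finally show ?thesis using small by simp
      qed
      have "(\<Sum>(x,k)\<in>p. measure lborel k *\<^sub>R h x) - (g b - g a) = (\<Sum>z\<in>p. ?err z)"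
        unfolding gdiff[symmetric] by (simp add: sum_subtractf case_prod_unfold)
      also have "norm \<dots> \<le> (\<Sum>z\<in>p. norm (?err z))" by (rule norm_sum)
      also have "\<dots> = (\<Sum>z\<in>p - pN. norm (?err z)) + (\<Sum>z\<in>pN. norm (?err z))"
        by (rule sum.subset_diff[OF sub fp])
      also have "(\<Sum>z\<in>p - pN. norm (?err z)) \<le> (\<Sum>z\<in>p - pN. e' * (case z of (x, k) \<Rightarrow> Sup k - Inf k))"
        by (rule sum_mono[OF regular])
      also have "\<dots> \<le> (\<Sum>z\<in>p. e' * (case z of (x, k) \<Rightarrow> Sup k - Inf k))"
        using \<open>e' > 0\<close> fp by (intro sum_mono2) (auto dest!: interval)
      also have "\<dots> = e' * (b - a)"
        using len by (simp add: sum_distrib_left[symmetric] case_prod_unfold)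
      also have "\<dots> \<le> e / 2"
        using \<open>e > 0\<close> \<open>a \<le> b\<close> by (simp add: e'_def field_simps)
      finally show "norm ((\<Sum>(x,k)\<in>p. measure lborel k *\<^sub>R h x) - (g b - g a)) < e"
        using singular by simp
    qed
  qed
  then show ?thesis
    using has_integral_spike[OF \<open>negligible N\<close>, of "{a..b}" g' h] by (auto simp: h_def)
qed

section \<open>Nonnegativity up to a first exit time\<close>

text \<open>
  Continuity argument behind (i) and (ii): lower bounds for \<open>f'\<close> are only available as long as
  \<open>f \<ge> 0\<close>, but they prevent \<open>f\<close> from becoming negative.
\<close>
lemma nonneg_continuation:
  fixes f f' :: "real \<Rightarrow> real"
  assumes deriv: "\<And>x. (f has_real_derivative f' x) (at x)"
    and "0 \<le> f a"
    and step: "\<And>t. \<lbrakk>t \<in> {a..b}; \<And>s. s \<in> {a..t} \<Longrightarrow> 0 \<le> f s\<rbrakk> \<Longrightarrow> 0 < f t \<or> 0 < f' t"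
    and "t \<in> {a..b}"
  shows "0 \<le> f t"
proof (rule ccontr)
  define S where "S = {t \<in> {a..b}. f t < 0}"
  assume "\<not> 0 \<le> f t"
  with \<open>t \<in> {a..b}\<close> have "t \<in> S" by (auto simp: S_def)
  have bdd: "bdd_below S" by (rule bdd_belowI[of _ a]) (auto simp: S_def)
  \<comment> \<open>\<open>m\<close> is the first exit time: \<open>f\<close> is nonnegative before
    it and, by continuity, at it.\<close>
  define m where "m = Inf S"
  have cont: "isCont f x" for x by (rule DERIV_isCont[OF deriv])
  have m_le: "m \<le> s" if "s \<in> S" for s
    unfolding m_def by (rule cInf_lower[OF that bdd])
  have m: "m \<in> {a..b}"
  proof -
    have "a \<le> m"
      unfolding m_def using \<open>t \<in> S\<close> by (intro cInf_greatest) (auto simp: S_def)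
    with m_le[OF \<open>t \<in> S\<close>] \<open>t \<in> {a..b}\<close> show ?thesis by simp
  qed
  have below: "0 \<le> f s" if "s \<in> {a..<m}" for s
    using that m m_le[of s] by (auto simp: S_def not_less[symmetric])
  have "0 \<le> f m"
  proof (cases "m = a")
    case False
    then have "a < m" using m by simp
    then have "\<forall>\<^sub>F s in at_left m. 0 \<le> f s"
      using below by (auto simp: eventually_at_left[OF \<open>a < m\<close>])
    moreover have "(f \<longlongrightarrow> f m) (at_left m)"
      using cont[of m] unfolding isCont_def by (rule tendsto_within_subset) simp
    ultimately show ?thesis by (intro tendsto_lowerbound) auto
  qed (use assms in simp)
  then have "0 < f m \<or> 0 < f' m"
    using step[OF m] below by (metis atLeastAtMost_iff atLeastLessThan_iff order_le_less)
  \<comment> \<open>Either \<open>f\<close> is positive at \<open>m\<close> and stays so nearby, or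
    it increases to the right of \<open>m\<close>. In both cases no point of \<open>S\<close> lies
    in an interval to the right of \<open>m\<close>, which contradicts the choice of the
    infimum.\<close>
  then obtain d where "d > 0" and d: "\<And>s. s \<in> {m..<m + d} \<Longrightarrow> 0 \<le> f s"
  proof (elim disjE)
    assume "0 < f m"
    then have "\<forall>\<^sub>F s in nhds m. 0 < f s"
      using cont[of m] by (auto simp: isCont_def tendsto_nhds_iff[symmetric] eventually_nhds_conv_at dest: order_tendstoD)
    then obtain d where "d > 0" "\<And>s. dist s m < d \<Longrightarrow> 0 < f s"
      unfolding eventually_nhds_metric by blast
    then show thesis by (intro that[of d]) (auto simp: dist_real_def less_imp_le)
  next
    assume "0 < f' m"
    from DERIV_pos_inc_right[OF deriv this] obtain d where "d > 0" "\<forall>h>0. h < d \<longrightarrow> f m < f (m + h)" by blast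
    then have "0 \<le> f s" if "s \<in> {m..<m + d}" for s
    proof (cases "s = m")
      case False
      with that have "0 < s - m" "s - m < d" by auto
      then have "f m < f (m + (s - m))" using \<open>\<forall>h>0. h < d \<longrightarrow> f m < f (m + h)\<close> by blast
      with \<open>0 \<le> f m\<close> show ?thesis by simp
    qed (use \<open>0 \<le> f m\<close> in simp)
    with \<open>d > 0\<close> show thesis by (rule that)
  qed
  have "m + d \<le> Inf S"
  proof (rule cInf_greatest)
    fix s assume "s \<in> S"
    then show "m + d \<le> s"
      using d[of s] m_le[of s] by (auto simp: S_def not_less[symmetric])
  qed (use \<open>t \<in> S\<close> in auto)
  with \<open>d > 0\<close> show False by (simp add: m_def)
qed

section \<open>Pointwise estimates from the integrated equation\<close>

lemma bounded_linear_Re_mult: "bounded_linear (\<lambda>z. Re (w * z))"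
  by (rule bounded_linear_compose[OF bounded_linear_Re bounded_linear_mult_right])

text \<open>
  The a.e. equation enters only through its integrated form, and \<open>V\<close> from below only through a bound
  on the integrals of \<open>V\<^sub>-\<close>. Both are invariant under \<open>x \<mapsto> - x\<close>, and \<open>c\<close> may be any positive upper bound
  of \<open>C\<^sub>2\<close>, which covers \<open>C\<^sub>2 = 0\<close> in part (vi).
\<close>
locale schrodinger_estimate =
  fixes V :: "real \<Rightarrow> real" and E :: complex and u u' :: "real \<Rightarrow> complex" and c :: real
  assumes c_pos: "0 < c"
    and deriv: "\<And>x. (u has_vector_derivative u' x) (at x)"
    and integrated_eq: "\<And>a b. a \<le> b \<Longrightarrow>
      ((\<lambda>x. (complex_of_real (V x) - E) * u x) has_integral u' b - u' a) {a..b}"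
    and negative_part_integrable: "\<And>a b. (\<lambda>x. max (- V x) 0) integrable_on {a..b}"
    and negative_part_bound: "\<And>a b. a \<le> b \<Longrightarrow>
      integral {a..b} (\<lambda>x. max (- V x) 0) + cmod E * (b - a) \<le> c * (1 + (b - a))"
begin

lemma continuous_u: "continuous_on S u"
  by (intro continuous_at_imp_continuous_on ballI has_vector_derivative_continuous[OF deriv])

text \<open>By the integrated equation, \<open>u'\<close> is locally a constant plus an indefinite
  integral.\<close>

lemma continuous_u': "continuous_on UNIV u'"
proof -
  have "isCont u' x" for x
  proof -
    let ?F = "\<lambda>y. integral {x - 1..y} (\<lambda>x. (complex_of_real (V x) - E) * u x)"
    have "continuous_on {x - 1..x + 1} (\<lambda>y. u' (x - 1) + ?F y)"
      using integrated_eq[of "x - 1" "x + 1"]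
      by (intro continuous_intros indefinite_integral_continuous_1) auto
    moreover have "u' (x - 1) + ?F y = u' y" if "y \<in> {x - 1..x + 1}" for y
      using integrated_eq[of "x - 1" y] that by (simp add: integral_unique)
    ultimately have "continuous_on {x - 1..x + 1} u'"
      using continuous_on_cong by (metis (no_types, lifting))
    then show ?thesis by (rule continuous_on_interior) simp
  qed
  then show ?thesis by (simp add: continuous_at_imp_continuous_on)
qed

text \<open>Every estimate below is first proved to the right of a point; applied to the reflected
  solution it yields the estimate to the left. The first derivative changes sign, the equation does
  not.\<close>

lemma reflect: "schrodinger_estimate (\<lambda>x. V (- x)) E (\<lambda>x. u (- x)) (\<lambda>x. - u' (- x)) c"
proof
  show "((\<lambda>x. u (- x)) has_vector_derivative - u' (- x)) (at x)" for x
  proof -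
    have "(uminus has_vector_derivative (- 1 :: real)) (at x)"
      by (rule derivative_eq_intros refl)+
    from vector_diff_chain_at[OF this deriv] show ?thesis by (simp add: o_def)
  qed
  show "((\<lambda>x. (complex_of_real (V (- x)) - E) * u (- x)) has_integral - u' (- b) - - u' (- a)) {a..b}"
    if "a \<le> b" for a b
    using has_integral_reflect_lemma_real[OF integrated_eq[of "- b" "- a"]] that by simp
  show "(\<lambda>x. max (- V (- x)) 0) integrable_on {a..b}" for a b
    using has_integral_reflect_lemma_real[OF integrable_integral[OF negative_part_integrable[of "- b" "- a"]]]
    by (auto simp: integrable_on_def)
  show "integral {a..b} (\<lambda>x. max (- V (- x)) 0) + cmod E * (b - a) \<le> c * (1 + (b - a))"
    if "a \<le> b" for a b
    using negative_part_bound[of "- b" "- a"] that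
      Henstock_Kurzweil_Integration.integral_reflect_real[of "- a" "- b" "\<lambda>x. max (- V x) 0"] by simp
qed (rule c_pos)

lemma Re_deriv: "((\<lambda>t. Re (w * u t)) has_real_derivative Re (w * u' t)) (at t)"
  using bounded_linear.has_vector_derivative[OF bounded_linear_Re_mult deriv]
  by (simp add: has_real_derivative_iff_has_vector_derivative del: times_complex.sel)

text \<open>For f = Re (w u) with 0 \<le> f \<le> M, the equation gives f'' = V f - Re (w E u) \<ge>
  -(V_- + |E|) M almost everywhere; integrating over [a, b] bounds the drop of f' by
  \<open>negative_part_bound\<close>. The sign of f is what allows V to be replaced by -V_-.\<close>

lemma Re_deriv_ge:
  assumes "a \<le> b" and w: "cmod w = 1"
    and M: "\<And>t. t \<in> {a..b} \<Longrightarrow> cmod (u t) \<le> M"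
    and nonneg: "\<And>t. t \<in> {a..b} \<Longrightarrow> 0 \<le> Re (w * u t)"
  shows "Re (w * u' a) - c * (1 + (b - a)) * M \<le> Re (w * u' b)"
proof -
  let ?W = "\<lambda>x. max (- V x) 0"
  have "0 \<le> M" using order_trans[OF norm_ge_zero M[of a]] \<open>a \<le> b\<close> by simp
  have "((\<lambda>x. - ((?W x + cmod E) * M)) has_integral
      - ((integral {a..b} ?W + cmod E * (b - a)) * M)) {a..b}"
    using has_integral_const_real[of "cmod E" a b] \<open>a \<le> b\<close>
    by (intro has_integral_neg has_integral_mult_left has_integral_add
      integrable_integral negative_part_integrable) (simp add: mult.commute)
  moreover have "((\<lambda>x. Re (w * ((complex_of_real (V x) - E) * u x))) has_integral Re (w * (u' b - u' a))) {a..b}"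
    using has_integral_linear[OF integrated_eq[OF \<open>a \<le> b\<close>] bounded_linear_Re_mult]
    by (simp add: o_def del: times_complex.sel)
  moreover have "- ((?W x + cmod E) * M) \<le> Re (w * ((complex_of_real (V x) - E) * u x))"
    if x: "x \<in> {a..b}" for x
  proof -
    have "Re (w * u x) \<le> M"
      using complex_Re_le_cmod[of "w * u x"] M[OF x] w by (simp add: norm_mult)
    then have "?W x * Re (w * u x) \<le> ?W x * M"
      by (intro mult_left_mono) auto
    moreover have "- ?W x * Re (w * u x) \<le> V x * Re (w * u x)"
      using nonneg[OF x] by (intro mult_right_mono) auto
    moreover have "Re (w * (E * u x)) \<le> cmod E * M"
      using complex_Re_le_cmod[of "w * (E * u x)"] M[OF x] w
      by (simp add: norm_mult) (meson mult_left_mono norm_ge_zero order_trans)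
    moreover have "Re (w * ((complex_of_real (V x) - E) * u x)) = V x * Re (w * u x) - Re (w * (E * u x))"
    proof -
      have "w * ((complex_of_real (V x) - E) * u x) = complex_of_real (V x) * (w * u x) - w * (E * u x)"
        by (simp add: algebra_simps)
      then show ?thesis by (simp only: minus_complex.sel Re_complex_of_real times_complex.sel Im_complex_of_real)
    qed
    ultimately show ?thesis
      by (simp add: algebra_simps del: times_complex.sel)
  qed
  ultimately have "- ((integral {a..b} ?W + cmod E * (b - a)) * M) \<le> Re (w * (u' b - u' a))"
    by (rule has_integral_le)
  moreover have "(integral {a..b} ?W + cmod E * (b - a)) * M \<le> c * (1 + (b - a)) * M"
    using negative_part_bound[OF \<open>a \<le> b\<close>] \<open>0 \<le> M\<close> by (intro mult_right_mono)
  ultimately show ?thesis by (simp add: right_diff_distrib del: times_complex.sel)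
qed

text \<open>On an interval of length K, f' drops by at most c (1 + K) M, so f'(x) > c (1 + K) M + M
  / K would make f grow by more than M, although f \<le> |u| \<le> M. The choice K = 1 /
  \<open>sqrt c\<close> minimises this threshold, with value (c + 2 \<open>sqrt c\<close>)
  M.\<close>

lemma deriv_bound_outward:
  assumes w: "cmod w = 1" "w * u' x = cmod (u' x)" and nonneg: "0 \<le> Re (w * u x)"
    and M: "\<And>y. y \<in> {x..x + 1 / sqrt c} \<Longrightarrow> cmod (u y) \<le> M"
  shows "cmod (u' x) \<le> (c + 2 * sqrt c) * M"
proof (rule ccontr)
  let ?K = "1 / sqrt c" and ?f = "\<lambda>t. Re (w * u t)" and ?f' = "\<lambda>t. Re (w * u' t)"
  assume "\<not> ?thesis"
  then have large: "(c + 2 * sqrt c) * M < ?f' x" using w(2) by (simp del: times_complex.sel)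
  have K: "0 < ?K" "c * ?K = sqrt c" "?K * sqrt c = 1"
    using c_pos by (simp_all add: real_div_sqrt)
  have "0 \<le> M" using order_trans[OF norm_ge_zero M[of x]] K(1) by simp
  have step: "sqrt c * M < ?f' t" if t: "t \<in> {x..x + ?K}" and "\<And>s. s \<in> {x..t} \<Longrightarrow> 0 \<le> ?f s" for t
  proof -
    have "?f' x - c * (1 + (t - x)) * M \<le> ?f' t"
      using that w(1) by (intro Re_deriv_ge M) auto
    \<comment> \<open>Since \<open>c * ?K = sqrt c\<close>, the drop is at most
      \<open>(c + sqrt c) * M\<close>, which leaves a slope above \<open>sqrt c * M\<close>.\<close>
    moreover have "c * (1 + (t - x)) * M \<le> c * (1 + ?K) * M"
      using t c_pos \<open>0 \<le> M\<close> by (intro mult_right_mono mult_left_mono) auto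
    moreover have "c * (1 + ?K) * M = (c + sqrt c) * M"
      using K(2) by (simp add: distrib_left)
    ultimately show ?thesis using large by (simp add: algebra_simps)
  qed
  have "0 \<le> sqrt c * M" using \<open>0 \<le> M\<close> c_pos by simp
  then have pos: "0 \<le> ?f t" if "t \<in> {x..x + ?K}" for t
    using nonneg_continuation[of ?f ?f' x "x + ?K" t] Re_deriv nonneg that step by force
  obtain z where z: "x < z" "z < x + ?K" "?f (x + ?K) - ?f x = ?K * ?f' z"
    using MVT2[of x "x + ?K" ?f ?f'] Re_deriv K(1) by auto
  have "?K * (sqrt c * M) < ?K * ?f' z"
    using z K(1) by (intro mult_strict_left_mono step pos) auto
  moreover have "?K * (sqrt c * M) = M" by (simp only: mult.assoc[symmetric] K(3) mult_1_left)
  ultimately have "M < ?f (x + ?K)" using z(3) nonneg by simp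
  also have "\<dots> \<le> M"
    using complex_Re_le_cmod[of "w * u (x + ?K)"] M[of "x + ?K"] w(1) K(1) by (simp add: norm_mult)
  finally show False by simp
qed

lemma deriv_bound:
  assumes M: "\<And>y. y \<in> {x - 1 / sqrt c..x + 1 / sqrt c} \<Longrightarrow> cmod (u y) \<le> M"
  shows "cmod (u' x) \<le> (c + 2 * sqrt c) * M"
proof -
  \<comment> \<open>The phase that makes \<open>w * u' x\<close> real and nonnegative; any
    unimodular number serves when \<open>u' x = 0\<close>.\<close>
  obtain w where w: "cmod w = 1" "w * u' x = cmod (u' x)"
  proof (cases "u' x = 0")
    case False
    then show thesis
      by (intro that[of "cnj (u' x) / cmod (u' x)"])
        (simp_all add: norm_divide complex_norm_square[symmetric] power2_eq_square mult.commute[of "cnj _"])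
  qed (auto intro: that[of 1])
  have "0 < 1 / sqrt c" using c_pos by simp
  show ?thesis
  proof (cases "0 \<le> Re (w * u x)")
    case True
    then show ?thesis using \<open>0 < 1 / sqrt c\<close> by (intro deriv_bound_outward[OF w] M) auto
  next
    case False
    interpret r: schrodinger_estimate "\<lambda>x. V (- x)" E "\<lambda>x. u (- x)" "\<lambda>x. - u' (- x)" c
      by (rule reflect)
    \<comment> \<open>Reflection negates the derivative, so the phase becomes \<open>- w\<close>,
      and \<open>Re (- w * u x)\<close> is positive exactly because \<open>Re (w * u x)\<close> is
      negative.\<close>
    show ?thesis
      using r.deriv_bound_outward[of "- w" "- x" M] w False M \<open>0 < 1 / sqrt c\<close> by auto
  qed
qed

text \<open>
  The comparison starts at the maximum point \<open>z\<close> of \<open>|u|\<close> on \<open>[x, y]\<close>, where \<open>|u(z)|\<close> bounds \<open>u\<close>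
  and \<open>Re (cnj (u z) * u' z) \<ge> 0\<close> still holds.
\<close>
lemma half_lower_bound:
  assumes \<delta>: "0 < \<delta>" "c * (\<delta> * (1 + \<delta>)) = 1 / 2"
    and "u x \<noteq> 0" and outward: "0 \<le> Re (cnj (u x) * u' x)" and y: "y \<in> {x..<x + \<delta>}"
  shows "cmod (u x) / 2 < cmod (u y)"
proof -
  obtain z where z: "z \<in> {x..y}" and zmax: "\<And>t. t \<in> {x..y} \<Longrightarrow> cmod (u t) \<le> cmod (u z)"
    using continuous_attains_sup[of "{x..y}" "\<lambda>t. cmod (u t)"] y continuous_on_norm[OF continuous_u]
    by fastforce
  define b where "b = cmod (u z)"
  have xb: "cmod (u x) \<le> b" using zmax[of x] y by (simp add: b_def)
  have ux: "0 < cmod (u x)" using \<open>u x \<noteq> 0\<close> by simp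
  with xb have "0 < b" by linarith
  show ?thesis
  proof (cases "z = y")
    case True
    then have "b = cmod (u y)" by (simp add: b_def)
    then show ?thesis using xb ux by linarith
  next
    case False
    define w where "w = cnj (u z) / b"
    have w: "cmod w = 1" using \<open>0 < b\<close> by (simp add: w_def b_def norm_divide)
    let ?f = "\<lambda>t. Re (w * u t)" and ?f' = "\<lambda>t. Re (w * u' t)"
    have fz: "?f z = b"
    proof -
      have "w * u z = b"
        using \<open>0 < b\<close> by (simp add: w_def b_def complex_norm_square[symmetric] power2_eq_square mult.commute[of "cnj _"])
      then show ?thesis by (simp del: times_complex.sel)
    qed
    \<comment> \<open>At a maximum point \<open>z\<close> strictly between \<open>x\<close> and
      \<open>y\<close> the derivative of |u|^2, which is twice this quantity, vanishes; at
      \<open>z = x\<close> the sign is the hypothesis \<open>outward\<close>. The case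
      \<open>z = y\<close> has been settled before.\<close>
    have "0 \<le> Re (cnj (u z) * u' z)"
    proof (cases "z = x")
      case False
      have "((\<lambda>t. u t \<bullet> u t) has_real_derivative 2 * (u z \<bullet> u' z)) (at z)"
        using deriv[of z] unfolding has_real_derivative_iff_has_vector_derivative
        by (auto intro!: derivative_eq_intros simp: has_vector_derivative_def inner_commute)
      moreover have "0 < min (z - x) (y - z)" using z False \<open>z \<noteq> y\<close> by auto
      moreover have "\<forall>t. \<bar>z - t\<bar> < min (z - x) (y - z) \<longrightarrow> u t \<bullet> u t \<le> u z \<bullet> u z"
      proof (intro allI impI)
        fix t assume "\<bar>z - t\<bar> < min (z - x) (y - z)"
        then have "t \<in> {x..y}" by auto
        from zmax[OF this] show "u t \<bullet> u t \<le> u z \<bullet> u z" by (simp add: dot_square_norm)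
      qed
      ultimately have "2 * (u z \<bullet> u' z) = 0" by (rule DERIV_local_max)
      then show ?thesis by (simp add: inner_complex_def)
    qed (use outward in simp)
    then have f'z: "0 \<le> ?f' z"
      using \<open>0 < b\<close> by (simp add: w_def times_divide_eq_left Re_divide_of_real del: times_complex.sel)
    \<comment> \<open>By the mean value theorem, f falls from \<open>b\<close> by at most
      \<open>(t - z) * (c * (1 + \<delta>) * b)\<close>. Since \<open>t - z < \<delta>\<close>, this
      is strictly less than \<open>b / 2\<close> by the equation for \<delta>.\<close>
    have step: "b / 2 < ?f t" if t: "t \<in> {z..y}" and pos: "\<And>s. s \<in> {z..t} \<Longrightarrow> 0 \<le> ?f s" for t
    proof (cases "t = z")
      case False
      with t have "z < t" by simp
      then obtain s where s: "z < s" "s < t" "?f t - ?f z = (t - z) * ?f' s"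
        using MVT2[of z t ?f ?f'] Re_deriv by auto
      have "?f' z - c * (1 + (s - z)) * b \<le> ?f' s"
        using s t z w pos zmax by (intro Re_deriv_ge) (auto simp: b_def)
      moreover have "c * (1 + (s - z)) * b \<le> c * (1 + \<delta>) * b"
        using s t z y c_pos \<open>0 < b\<close> by (intro mult_right_mono mult_left_mono) auto
      ultimately have "- (c * (1 + \<delta>) * b) \<le> ?f' s" using f'z by linarith
      then have "(t - z) * - (c * (1 + \<delta>) * b) \<le> ?f t - ?f z"
        unfolding s(3) using \<open>z < t\<close> by (intro mult_left_mono) auto
      moreover have "(t - z) * (c * (1 + \<delta>) * b) < \<delta> * (c * (1 + \<delta>) * b)"
        using t z y c_pos \<delta>(1) \<open>0 < b\<close> by (intro mult_strict_right_mono) auto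
      moreover have "\<delta> * (c * (1 + \<delta>) * b) = b / 2"
      proof -
        have "\<delta> * (c * (1 + \<delta>) * b) = c * (\<delta> * (1 + \<delta>)) * b" by (simp only: mult_ac)
        then show ?thesis by (simp only: \<delta>(2))
      qed
      ultimately show ?thesis using fz by simp
    qed (use fz \<open>0 < b\<close> in simp)
    have "0 \<le> ?f t" if "t \<in> {z..y}" for t
      using nonneg_continuation[of ?f ?f' z y t] Re_deriv that step fz \<open>0 < b\<close> by force
    then have "b / 2 < ?f y" using step[of y] z by auto
    also have "\<dots> \<le> cmod (u y)" using complex_Re_le_cmod[of "w * u y"] w by (simp add: norm_mult)
    finally show ?thesis using xb by simp
  qed
qed

end

section \<open>Bounds by local integrals of powers of |u|\<close>

text \<open>The interval is half-open to match \<open>half_lower_bound\<close>, which says nothing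
  at the endpoint \<open>x + \<delta>\<close>.\<close>

lemma set_integral_ge_const:
  fixes f :: "real \<Rightarrow> real"
  assumes f: "set_integrable lebesgue A f" and "c \<le> d" "{c..<d} \<subseteq> A"
    and nonneg: "\<And>y. 0 \<le> f y" and k: "\<And>y. y \<in> {c..<d} \<Longrightarrow> k \<le> f y"
  shows "k * (d - c) \<le> (LINT y:A|lebesgue. f y)"
proof -
  have sub: "set_integrable lebesgue {c..<d} f"
    by (rule set_integrable_subset[OF f]) (use assms in auto)
  have "k * (d - c) = (LINT y:{c..<d}|lebesgue. k)"
    using \<open>c \<le> d\<close> by (simp add: set_integral_const)
  also have "\<dots> \<le> (LINT y:{c..<d}|lebesgue. f y)"
  proof (rule set_integral_mono[OF _ sub k])
    show "set_integrable lebesgue {c..<d} (\<lambda>_. k)"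
      by (rule set_integrable_subset[of _ "{c..d}"]) (auto intro: absolutely_integrable_continuous_real)
  qed
  also have "\<dots> \<le> (LINT y:A|lebesgue. f y)"
    unfolding set_lebesgue_integral_def
    using sub f nonneg \<open>{c..<d} \<subseteq> A\<close>
    by (intro integral_mono) (auto simp: set_integrable_def indicator_def)
  finally show ?thesis .
qed

lemma set_integral_Icc_mono:
  fixes f :: "real \<Rightarrow> real"
  assumes "continuous_on UNIV f" "\<And>y. 0 \<le> f y" "{a..b} \<subseteq> {c..d}"
  shows "(LINT y:{a..b}|lebesgue. f y) \<le> (LINT y:{c..d}|lebesgue. f y)"
proof -
  have "set_integrable lebesgue {r..s} f" for r s
    by (intro absolutely_integrable_continuous_real continuous_on_subset[OF assms(1)]) simp
  then show ?thesis
    unfolding set_lebesgue_integral_def using assms(2,3)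
    by (intro integral_mono) (auto simp: set_integrable_def indicator_def)
qed

lemma set_integral_Icc_reflect:
  fixes f :: "real \<Rightarrow> real"
  shows "(LINT y:{- b..- a}|lebesgue. f (- y)) = (LINT y:{a..b}|lebesgue. f y)"
  using Equivalence_Lebesgue_Henstock_Integration.integral_reflect_real[of b a f]
  by (simp add: set_lebesgue_integral_def integral_restrict_space
    del: Equivalence_Lebesgue_Henstock_Integration.integral_reflect_real)

context schrodinger_estimate
begin

lemma continuous_powr: "0 < p \<Longrightarrow> continuous_on S (\<lambda>y. cmod (u y) powr p)"
  by (intro continuous_on_powr' continuous_on_norm continuous_u continuous_intros) auto

lemma powr_le_integral_outward:
  assumes \<delta>: "0 < \<delta>" "c * (\<delta> * (1 + \<delta>)) = 1 / 2" and p: "0 < p"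
    and "u x \<noteq> 0" "0 \<le> Re (cnj (u x) * u' x)"
  shows "cmod (u x) powr p \<le> 2 powr p / \<delta> * (LINT y:{x - \<delta>..x + \<delta>}|lebesgue. cmod (u y) powr p)"
proof -
  have "(cmod (u x) / 2) powr p * (x + \<delta> - x) \<le> (LINT y:{x - \<delta>..x + \<delta>}|lebesgue. cmod (u y) powr p)"
  proof (rule set_integral_ge_const)
    fix y assume "y \<in> {x..<x + \<delta>}"
    then have "cmod (u x) / 2 < cmod (u y)" by (rule half_lower_bound[OF \<delta> assms(4,5)])
    then show "(cmod (u x) / 2) powr p \<le> cmod (u y) powr p"
      using p by (intro powr_mono2) auto
  qed (use p \<delta>(1) in \<open>auto intro!: absolutely_integrable_continuous_real continuous_powr\<close>)
  then show ?thesis using \<delta>(1) by (simp add: powr_divide field_simps)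
qed

text \<open>If \<open>Re (cnj (u x) * u' x)\<close> is negative, the reflected solution satisfies
  the outward condition at \<open>- x\<close>; the window is symmetric about \<open>x\<close>, so
  both sides give the same bound.\<close>

lemma powr_le_integral:
  assumes \<delta>: "0 < \<delta>" "c * (\<delta> * (1 + \<delta>)) = 1 / 2" and p: "0 < p"
  shows "cmod (u x) powr p \<le> 2 powr p / \<delta> * (LINT y:{x - \<delta>..x + \<delta>}|lebesgue. cmod (u y) powr p)"
proof (cases "u x = 0")
  case True
  have "0 \<le> (LINT y:{x - \<delta>..x + \<delta>}|lebesgue. cmod (u y) powr p)"
    by (auto simp: set_lebesgue_integral_def intro!: integral_nonneg_AE)
  then show ?thesis using True \<delta>(1) by simp
next
  case False
  show ?thesis
  proof (cases "0 \<le> Re (cnj (u x) * u' x)")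
    case True
    then show ?thesis by (rule powr_le_integral_outward[OF \<delta> p False])
  next
    case out: False
    interpret r: schrodinger_estimate "\<lambda>x. V (- x)" E "\<lambda>x. u (- x)" "\<lambda>x. - u' (- x)" c
      by (rule reflect)
    show ?thesis
      using r.powr_le_integral_outward[OF \<delta> p, of "- x"] False out
        set_integral_Icc_reflect[of "x + \<delta>" "x - \<delta>" "\<lambda>y. cmod (u y) powr p"]
      by simp
  qed
qed

text \<open>The derivative bound reduces the claim to the maximum point \<open>z\<close> of |u|
  within distance \<open>K\<close>; the window of radius \<delta> around \<open>z\<close> lies in
  the larger window around \<open>x\<close>.\<close>

lemma deriv_powr_le_integral:
  assumes \<delta>: "0 < \<delta>" "c * (\<delta> * (1 + \<delta>)) = 1 / 2" and p: "0 < p" and K: "K = 1 / sqrt c"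
  shows "cmod (u' x) powr p \<le> 2 powr p * (c + 2 * sqrt c) powr p / \<delta> *
    (LINT y:{x - K - \<delta>..x + K + \<delta>}|lebesgue. cmod (u y) powr p)"
proof -
  have "0 < K" using c_pos by (simp add: K)
  obtain z where z: "z \<in> {x - K..x + K}" and zmax: "\<And>t. t \<in> {x - K..x + K} \<Longrightarrow> cmod (u t) \<le> cmod (u z)"
    using continuous_attains_sup[of "{x - K..x + K}" "\<lambda>t. cmod (u t)"] \<open>0 < K\<close>
      continuous_on_norm[OF continuous_u] by fastforce
  have "cmod (u' x) \<le> (c + 2 * sqrt c) * cmod (u z)"
    by (rule deriv_bound) (use zmax K in auto)
  then have "cmod (u' x) powr p \<le> (c + 2 * sqrt c) powr p * cmod (u z) powr p"
    using p c_pos by (subst powr_mult[symmetric]) (auto intro!: powr_mono2)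
  also have "\<dots> \<le> (c + 2 * sqrt c) powr p *
      (2 powr p / \<delta> * (LINT y:{x - K - \<delta>..x + K + \<delta>}|lebesgue. cmod (u y) powr p))"
  proof (rule mult_left_mono[OF order_trans[OF powr_le_integral[OF \<delta> p]]])
    show "2 powr p / \<delta> * (LINT y:{z - \<delta>..z + \<delta>}|lebesgue. cmod (u y) powr p)
        \<le> 2 powr p / \<delta> * (LINT y:{x - K - \<delta>..x + K + \<delta>}|lebesgue. cmod (u y) powr p)"
      using z p \<delta>(1) by (intro mult_left_mono set_integral_Icc_mono continuous_powr) auto
  qed simp
  finally show ?thesis by (simp add: mult_ac)
qed

end

section \<open>Decay at infinity from integrability\<close>

text \<open>Dominated convergence with majorant |F|: each fixed point is eventually outside the
  moving window. The path \<open>s\<close> lets one statement serve both ends of the line.\<close>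

lemma local_integral_tendsto_0:
  fixes F s :: "real \<Rightarrow> real"
  assumes F: "integrable lebesgue F" and s: "filterlim s at_infinity at_top"
  shows "((\<lambda>x. LINT y:{s x - R..s x + R}|lebesgue. F y) \<longlongrightarrow> 0) at_top"
proof -
  have "((\<lambda>x. LINT y|lebesgue. indicator {s x - R..s x + R} y *\<^sub>R F y) \<longlongrightarrow> (LINT y::real|lebesgue. 0::real)) at_top"
  proof (rule integral_dominated_convergence_at_top)
    show "AE y in lebesgue. ((\<lambda>x. indicator {s x - R..s x + R} y *\<^sub>R F y) \<longlongrightarrow> 0) at_top"
    proof (rule AE_I2, rule tendsto_eventually)
      fix y
      have "\<forall>\<^sub>F x in at_top. \<bar>y\<bar> + \<bar>R\<bar> + 1 \<le> norm (s x)"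
        using s by (simp add: filterlim_at_infinity[of 0])
      then show "\<forall>\<^sub>F x in at_top. indicator {s x - R..s x + R} y *\<^sub>R F y = 0"
        by eventually_elim (auto simp: indicator_def)
    qed
    show "\<forall>\<^sub>F x in at_top. AE y in lebesgue. norm (indicator {s x - R..s x + R} y *\<^sub>R F y) \<le> \<bar>F y\<bar>"
      by (auto simp: indicator_def)
    show "(\<lambda>y. indicator {s x - R..s x + R} y *\<^sub>R F y) \<in> borel_measurable lebesgue" for x
      by (intro borel_measurable_scaleR borel_measurable_indicator borel_measurable_integrable[OF F]) auto
  qed (use F in auto)
  then show ?thesis by (simp add: set_lebesgue_integral_def)
qed

lemma tendsto_0_of_powr_le_local_integral:
  fixes v :: "real \<Rightarrow> 'a::real_normed_vector"
  assumes F: "integrable lebesgue F" and p: "0 < p"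
    and bound: "\<And>x. norm (v x) powr p \<le> D * (LINT y:{x - R..x + R}|lebesgue. F y)"
  shows "(v \<longlongrightarrow> 0) at_top" "(v \<longlongrightarrow> 0) at_bot"
proof -
  have *: "((\<lambda>x. v (s x)) \<longlongrightarrow> 0) at_top" if s: "filterlim s at_infinity at_top" for s :: "real \<Rightarrow> real"
  proof -
    have upper: "((\<lambda>x. D * (LINT y:{s x - R..s x + R}|lebesgue. F y)) \<longlongrightarrow> 0) at_top"
      using tendsto_mult_left[OF local_integral_tendsto_0[OF F s]] by simp
    have "((\<lambda>x. norm (v (s x)) powr p) \<longlongrightarrow> 0) at_top"
      by (rule tendsto_sandwich[OF _ _ tendsto_const upper]) (use bound in auto)
    then have "((\<lambda>x. (norm (v (s x)) powr p) powr (1 / p)) \<longlongrightarrow> 0) at_top"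
      by (rule tendsto_zero_powrI[OF _ tendsto_const]) (use p in auto)
    then show ?thesis using p by (simp add: powr_powr tendsto_norm_zero_iff)
  qed
  show "(v \<longlongrightarrow> 0) at_top"
    using *[of "\<lambda>x. x"] by (simp add: filterlim_at_top_imp_at_infinity filterlim_ident)
  show "(v \<longlongrightarrow> 0) at_bot"
    unfolding filterlim_at_bot_mirror
    by (rule *[OF filterlim_mono[OF filterlim_uminus_at_bot_at_top at_bot_le_at_infinity order_refl]])
qed

section \<open>Integrating a local bound against a weight\<close>

text \<open>
  Tonelli's theorem needs an integrand measurable on the product, so \<open>w F\<close>, which is only Lebesgue
  measurable, is replaced by a Borel representative \<open>H\<close>.
\<close>
lemma weighted_integrable_of_local_integral_bound:
  fixes F G w :: "real \<Rightarrow> real"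
  assumes F: "continuous_on UNIV F" "\<And>y. 0 \<le> F y" and G: "continuous_on UNIV G" "\<And>y. 0 \<le> G y"
    and w: "w \<in> borel_measurable lebesgue" "\<And>x. 0 < w x"
    and A: "\<And>x y. \<bar>x - y\<bar> \<le> R \<Longrightarrow> w x \<le> A * w y" and "0 \<le> R" "0 \<le> D"
    and bound: "\<And>x. G x \<le> D * (LINT y:{x - R..x + R}|lebesgue. F y)"
    and int: "integrable lebesgue (\<lambda>x. w x * F x)"
  shows "integrable lebesgue (\<lambda>x. w x * G x)"
proof -
  have "0 \<le> A" using A[of 0 0] w(2)[of 0] \<open>0 \<le> R\<close> by (simp add: zero_le_mult_iff)
  have meas: "F \<in> borel_measurable lebesgue" "G \<in> borel_measurable lebesgue"
    using F(1) G(1) by (auto intro!: measurable_completion borel_measurable_continuous_onI)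
  obtain H where H: "H \<in> borel_measurable lborel" and HF: "AE y in lborel. ennreal (w y * F y) = H y"
    using completion_ex_borel_measurable[of "\<lambda>y. ennreal (w y * F y)" lborel] w(1) meas(1) by auto
  have [measurable]: "H \<in> borel_measurable borel" using H by simp
  let ?I = "\<lambda>x y. indicator {x - R..x + R} y :: ennreal"
  \<comment> \<open>On the window, \<open>w x \<le> A * w y\<close> moves the weight inside the
    integral at the cost of the factor \<open>A\<close>.\<close>
  have pointwise: "ennreal (w x * G x) \<le> ennreal (D * A) * (\<integral>\<^sup>+y. H y * ?I x y \<partial>lborel)" for x
  proof -
    have Fint: "set_integrable lebesgue {x - R..x + R} F"
      by (intro absolutely_integrable_continuous_real continuous_on_subset[OF F(1)]) simp
    have "w x * G x \<le> w x * (D * (LINT y:{x - R..x + R}|lebesgue. F y))"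
      using bound[of x] w(2)[of x] by (intro mult_left_mono) auto
    then have "ennreal (w x * G x) \<le> ennreal (w x * D) * ennreal (LINT y:{x - R..x + R}|lebesgue. F y)"
      using w(2)[of x] \<open>0 \<le> D\<close> by (subst ennreal_mult'[symmetric]) (auto simp: mult_ac intro!: ennreal_leI)
    also have "ennreal (LINT y:{x - R..x + R}|lebesgue. F y)
        = (\<integral>\<^sup>+y. ennreal (indicator {x - R..x + R} y *\<^sub>R F y) \<partial>lebesgue)"
      unfolding set_lebesgue_integral_def
      by (rule nn_integral_eq_integral[symmetric]) (use Fint F(2) in \<open>auto simp: set_integrable_def\<close>)
    also have "ennreal (w x * D) * \<dots> = (\<integral>\<^sup>+y. ennreal (w x * D) * ennreal (indicator {x - R..x + R} y *\<^sub>R F y) \<partial>lebesgue)"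
      by (rule nn_integral_cmult[symmetric]) (use Fint in \<open>auto simp: set_integrable_def intro: borel_measurable_integrable\<close>)
    also have "\<dots> \<le> (\<integral>\<^sup>+y. ennreal (D * A) * (ennreal (w y * F y) * ?I x y) \<partial>lebesgue)"
    proof (rule nn_integral_mono)
      fix y
      show "ennreal (w x * D) * ennreal (indicator {x - R..x + R} y *\<^sub>R F y)
          \<le> ennreal (D * A) * (ennreal (w y * F y) * ?I x y)"
      proof (cases "y \<in> {x - R..x + R}")
        case True
        then have "w x \<le> A * w y" by (intro A) auto
        then have "w x * (D * F y) \<le> A * w y * (D * F y)"
          using \<open>0 \<le> D\<close> F(2)[of y] by (intro mult_right_mono) auto
        then have "w x * D * F y \<le> D * A * (w y * F y)" by (simp add: mult_ac)
        then show ?thesis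
          using True w(2)[of x] w(2)[of y] \<open>0 \<le> D\<close> \<open>0 \<le> A\<close> F(2)[of y]
          by (simp add: ennreal_mult[symmetric] ennreal_leI)
      qed simp
    qed
    also have "\<dots> = (\<integral>\<^sup>+y. ennreal (D * A) * (H y * ?I x y) \<partial>lborel)"
      unfolding nn_integral_completion using HF by (intro nn_integral_cong_AE) auto
    also have "\<dots> = ennreal (D * A) * (\<integral>\<^sup>+y. H y * ?I x y \<partial>lborel)"
      by (rule nn_integral_cmult) measurable
    finally show ?thesis .
  qed
  have Imeas[measurable]: "(\<lambda>(x, y). ?I x y) \<in> borel_measurable (borel \<Otimes>\<^sub>M borel)"
  proof -
    have "(\<lambda>(x, y). ?I x y) = (\<lambda>z. indicator {z. fst z - R \<le> snd z \<and> snd z \<le> fst z + R} z)"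
      by (auto simp: indicator_def)
    also have "\<dots> \<in> borel_measurable (borel \<Otimes>\<^sub>M borel)"
      by measurable
    finally show ?thesis .
  qed
  have "(\<integral>\<^sup>+x. ennreal (w x * G x) \<partial>lebesgue) \<le> (\<integral>\<^sup>+x. ennreal (D * A) * (\<integral>\<^sup>+y. H y * ?I x y \<partial>lborel) \<partial>lborel)"
    unfolding nn_integral_completion by (intro nn_integral_mono pointwise)
  also have "\<dots> = ennreal (D * A) * (\<integral>\<^sup>+x. \<integral>\<^sup>+y. H y * ?I x y \<partial>lborel \<partial>lborel)"
    by (rule nn_integral_cmult) measurable
  \<comment> \<open>The kernel is the indicator of |x - y| \<le> \<open>R\<close>, symmetric in both
    variables; after the exchange the inner integral is \<open>2 * R\<close> times
    \<open>H y\<close>.\<close>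
  also have "(\<integral>\<^sup>+x. \<integral>\<^sup>+y. H y * ?I x y \<partial>lborel \<partial>lborel) = (\<integral>\<^sup>+y. \<integral>\<^sup>+x. H y * ?I x y \<partial>lborel \<partial>lborel)"
    by (rule lborel_pair.Fubini'[symmetric]) measurable
  also have "\<dots> = (\<integral>\<^sup>+y. H y * ennreal (2 * R) \<partial>lborel)"
  proof (rule nn_integral_cong)
    fix y
    have "(\<integral>\<^sup>+x. H y * ?I x y \<partial>lborel) = (\<integral>\<^sup>+x. H y * indicator {y - R..y + R} x \<partial>lborel)"
      by (rule nn_integral_cong) (auto simp: indicator_def)
    also have "\<dots> = H y * ennreal (2 * R)"
      using \<open>0 \<le> R\<close> by (subst nn_integral_cmult_indicator) auto
    finally show "(\<integral>\<^sup>+x. H y * ?I x y \<partial>lborel) = H y * ennreal (2 * R)" .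
  qed
  also have "\<dots> = (\<integral>\<^sup>+y. H y \<partial>lborel) * ennreal (2 * R)"
    by (rule nn_integral_multc) measurable
  also have "(\<integral>\<^sup>+y. H y \<partial>lborel) = (\<integral>\<^sup>+y. ennreal (w y * F y) \<partial>lebesgue)"
    unfolding nn_integral_completion using HF by (intro nn_integral_cong_AE) auto
  also have "ennreal (D * A) * ((\<integral>\<^sup>+y. ennreal (w y * F y) \<partial>lebesgue) * ennreal (2 * R)) < \<infinity>"
    using int F(2) w(2)
    by (auto simp: integrable_iff_bounded abs_of_nonneg less_imp_le ennreal_mult_less_top)
  finally show ?thesis
    using meas w G(2) by (intro integrableI_nonneg) (auto simp: less_imp_le)
qed

section \<open>From the almost everywhere equation to the estimates, and the choice of
  \<delta>\<close>

lemma schrodinger_solution_estimate: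
  assumes V: "locally_integrable V"
    and C1: "\<And>x. (LINT y:{x..x+1}|lebesgue. max (- V y) 0) \<le> C1"
    and u: "schrodinger_solution V E u"
    and c: "C1 + cmod E \<le> c" "0 < c"
  shows "schrodinger_estimate V E u (vderiv u) c"
proof
  let ?W = "\<lambda>x. max (- V x) 0"
  show "(u has_vector_derivative vderiv u x) (at x)" for x
    using u by (simp add: schrodinger_solution_def vector_derivative_works)
  show "((\<lambda>x. (complex_of_real (V x) - E) * u x) has_integral vderiv u b - vderiv u a) {a..b}"
    if "a \<le> b" for a b
  proof -
    obtain N where N: "N \<in> null_sets lebesgue"
      "{x \<in> space lebesgue. \<not> (vderiv u differentiable (at x) \<and>
        - vderiv (vderiv u) x + complex_of_real (V x) * u x = E * u x)} \<subseteq> N"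
      using u unfolding schrodinger_solution_def eventually_ae_filter by blast
    show ?thesis
    \<comment> \<open>Absolute continuity of the derivative is used here: the equation holds only
      off the null set \<open>N\<close>, yet it integrates to the increments of
      \<open>vderiv u\<close>.\<close>
    proof (rule absolutely_continuous_on_has_integral[OF _ that])
      show "absolutely_continuous_on {a..b} (vderiv u)"
        using u by (simp add: schrodinger_solution_def)
      show "negligible N" using N(1) by (simp add: negligible_iff_null_sets)
      fix x assume "x \<in> {a..b} - N"
      then have x: "vderiv u differentiable (at x)"
        "- vderiv (vderiv u) x + complex_of_real (V x) * u x = E * u x"
        using N(2) by auto
      from x(2) have "vderiv (vderiv u) x = (complex_of_real (V x) - E) * u x"
        by (simp add: algebra_simps add_eq_0_iff)
      with x(1) show "(vderiv u has_vector_derivative (complex_of_real (V x) - E) * u x) (at x within {a..b})"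
        by (metis has_vector_derivative_at_within vector_derivative_works)
    qed
  qed
  have abs_int: "?W absolutely_integrable_on {a..b}" for a b
  proof -
    have "V absolutely_integrable_on {a..b}" using V by (simp add: locally_integrable_def)
    then have "(\<lambda>x. (\<bar>V x\<bar> - V x) / 2) absolutely_integrable_on {a..b}"
      by (intro set_integrable_abs set_integral_diff set_integrable_divide)
    moreover have "(\<lambda>x. (\<bar>V x\<bar> - V x) / 2) = ?W" by (auto simp: max_def)
    ultimately show ?thesis by simp
  qed
  show int: "?W integrable_on {a..b}" for a b
    by (rule set_lebesgue_integral_eq_integral(1)[OF abs_int])
  have unit: "integral {a..a + 1} ?W \<le> C1" for a
    using C1[of a] set_lebesgue_integral_eq_integral(2)[OF abs_int] by simp
  have "0 \<le> C1" by (rule order_trans[OF integral_nonneg[OF int] unit[of 0]]) auto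
  have steps: "integral {a..a + real n} ?W \<le> real n * C1" for a n
  proof (induction n)
    case (Suc n)
    have "integral {a..a + real n} ?W + integral {a + real n..a + real n + 1} ?W = integral {a..a + real n + 1} ?W"
      by (rule Henstock_Kurzweil_Integration.integral_combine) (auto intro: int)
    with Suc unit[of "a + real n"] show ?case by (simp add: algebra_simps)
  qed simp
  show "integral {a..b} ?W + cmod E * (b - a) \<le> c * (1 + (b - a))" if "a \<le> b" for a b
  proof -
    \<comment> \<open>An interval of length l is covered by \<open>n\<close> unit intervals with
      \<open>n\<close> at most 1 + l, each carrying at most \<open>C1\<close>; hence the factor 1 +
      l in the bound.\<close>
    define n where "n = nat \<lceil>b - a\<rceil>"
    have n: "b - a \<le> real n" "real n \<le> 1 + (b - a)"
      using that unfolding n_def by linarith+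
    have "integral {a..b} ?W \<le> integral {a..a + real n} ?W"
      using n by (intro integral_subset_le int) auto
    also have "\<dots> \<le> real n * C1" by (rule steps)
    also have "\<dots> \<le> (1 + (b - a)) * C1" using n \<open>0 \<le> C1\<close> by (intro mult_right_mono)
    finally have "integral {a..b} ?W + cmod E * (b - a) \<le> (1 + (b - a)) * C1 + cmod E * (1 + (b - a))"
      using that by (intro add_mono mult_left_mono) auto
    also have "\<dots> \<le> c * (1 + (b - a))"
      using mult_right_mono[OF c(1), of "1 + (b - a)"] that by (simp add: algebra_simps)
    finally show ?thesis .
  qed
qed (rule c(2))

text \<open>\<delta> is the positive root of 2 c t (1 + t) = 1; only this equation and positivity
  enter the estimates.\<close>

lemma half_length_equation:
  assumes "0 < c" and d: "d = - 1 / 2 + sqrt (1 / 4 + 1 / (2 * c))"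
  shows "0 < d" "c * (d * (1 + d)) = 1 / 2"
proof -
  have "sqrt (1 / 4) < sqrt (1 / 4 + 1 / (2 * c))" using \<open>0 < c\<close> by simp
  moreover have "sqrt (1 / 4) = (1 / 2 :: real)" by (simp add: real_sqrt_divide)
  ultimately show "0 < d" by (simp add: d)
  have "(d + 1 / 2)\<^sup>2 = 1 / 4 + 1 / (2 * c)" using \<open>0 < c\<close> by (simp add: d)
  then have "d * (1 + d) = 1 / (2 * c)" by (simp add: power2_eq_square algebra_simps)
  then show "c * (d * (1 + d)) = 1 / 2" using \<open>0 < c\<close> by simp
qed

section \<open>Consequences of membership in L^p\<close>

context schrodinger_estimate
begin

lemma Lp_density_deriv:
  assumes \<delta>: "0 < \<delta>" "c * (\<delta> * (1 + \<delta>)) = 1 / 2" and K: "K = 1 / sqrt c"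
    and p: "1 \<le> p" and w: "w \<in> borel_measurable lebesgue" "\<And>x. 0 < w x"
    and A: "bdd_above {w x / w y | x y. \<bar>x - y\<bar> \<le> K + \<delta>}"
    and u: "u \<in> Lp_space p (density lebesgue (\<lambda>x. ennreal (w x)))"
  shows "u' \<in> Lp_space p (density lebesgue (\<lambda>x. ennreal (w x)))"
proof -
  have "0 < K" using c_pos by (simp add: K)
  have meas: "u' \<in> borel_measurable (density lebesgue (\<lambda>x. ennreal (w x)))"
    using continuous_u' by (simp add: measurable_completion borel_measurable_continuous_onI)
  show ?thesis
  proof (cases "p = \<infinity>")
    case True
    with u obtain B where "AE x in density lebesgue (\<lambda>x. ennreal (w x)). cmod (u x) \<le> B"
      by (auto simp: Lp_space_def)
    then have "AE x in lebesgue. cmod (u x) \<le> B"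
      using w by (simp add: AE_density)
    then have B: "AE x in lborel. cmod (u x) \<le> B" by (simp add: AE_completion_iff)
    \<comment> \<open>Positivity of \<open>w\<close> has removed the weight from the null sets. By
      continuity of \<open>u\<close> the almost everywhere bound holds on a closed set, hence
      everywhere, and \<open>deriv_bound\<close> applies at each point.\<close>
    have "closed {x. cmod (u x) \<le> B}"
      by (intro closed_Collect_le continuous_on_norm continuous_u continuous_intros)
    then have "cmod (u x) \<le> B" for x
      using mem_closed_if_AE_lebesgue[of "{x. cmod (u x) \<le> B}"] AE_completion[OF B] by simp
    then have "cmod (u' x) \<le> (c + 2 * sqrt c) * B" for x
      by (intro deriv_bound)
    then show ?thesis using True meas by (auto simp: Lp_space_def)
  next
    case False
    define q where "q = enn2real p"
    have "1 \<le> q" using p False by (cases p) (auto simp: q_def)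
    then have "0 < q" by simp
    obtain B where B: "\<And>x y. \<bar>x - y\<bar> \<le> K + \<delta> \<Longrightarrow> w x / w y \<le> B"
      using A unfolding bdd_above_def by blast
    have wB: "w x \<le> B * w y" if "\<bar>x - y\<bar> \<le> K + \<delta>" for x y
      using B[OF that] w(2)[of y] by (simp add: field_simps)
    have density: "integrable (density lebesgue (\<lambda>x. ennreal (w x))) f \<longleftrightarrow> integrable lebesgue (\<lambda>x. w x * f x)"
      if "continuous_on UNIV f" for f :: "real \<Rightarrow> real"
      using integrable_density[of f lebesgue w] w that
      by (simp add: measurable_completion borel_measurable_continuous_onI less_imp_le)
    have cont': "continuous_on UNIV (\<lambda>x. cmod (u' x) powr q)"
      using \<open>0 < q\<close> by (intro continuous_on_powr' continuous_on_norm continuous_u' continuous_intros) auto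
    have "integrable lebesgue (\<lambda>x. w x * cmod (u' x) powr q)"
    proof (rule weighted_integrable_of_local_integral_bound)
      show "cmod (u' x) powr q \<le> 2 powr q * (c + 2 * sqrt c) powr q / \<delta> *
          (LINT y:{x - (K + \<delta>)..x + (K + \<delta>)}|lebesgue. cmod (u y) powr q)" for x
        using deriv_powr_le_integral[OF \<delta> \<open>0 < q\<close> K, of x] by (simp add: algebra_simps)
      show "integrable lebesgue (\<lambda>x. w x * cmod (u x) powr q)"
        using u False density[OF continuous_powr[OF \<open>0 < q\<close>]] by (simp add: Lp_space_def q_def)
    qed (use wB w \<delta> \<open>0 < K\<close> \<open>0 < q\<close> cont' continuous_powr in auto)
    then have "integrable (density lebesgue (\<lambda>x. ennreal (w x))) (\<lambda>x. cmod (u' x) powr q)"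
      using density[OF cont'] by simp
    then show ?thesis using meas False by (simp add: Lp_space_def q_def)
  qed
qed

lemma Lp_tendsto_0:
  assumes p: "1 \<le> p" "p < \<infinity>" and u: "u \<in> Lp_space p lebesgue"
  shows "(u \<longlongrightarrow> 0) at_top" "(u \<longlongrightarrow> 0) at_bot" "(u' \<longlongrightarrow> 0) at_top" "(u' \<longlongrightarrow> 0) at_bot"
proof -
  define q where "q = enn2real p"
  have "1 \<le> q" using p by (cases p) (auto simp: q_def)
  then have "0 < q" by simp
  have int: "integrable lebesgue (\<lambda>x. cmod (u x) powr q)"
    using u p(2) by (auto simp: Lp_space_def q_def)
  define d where "d = - 1 / 2 + sqrt (1 / 4 + 1 / (2 * c))"
  note d = half_length_equation[OF c_pos d_def]
  show "(u \<longlongrightarrow> 0) at_top" "(u \<longlongrightarrow> 0) at_bot"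
    by (rule tendsto_0_of_powr_le_local_integral[OF int \<open>0 < q\<close> powr_le_integral[OF d \<open>0 < q\<close>]])+
  define K where "K = 1 / sqrt c"
  have "cmod (u' x) powr q \<le> 2 powr q * (c + 2 * sqrt c) powr q / d *
      (LINT y:{x - (K + d)..x + (K + d)}|lebesgue. cmod (u y) powr q)" for x
    using deriv_powr_le_integral[OF d \<open>0 < q\<close> K_def, of x] by (simp add: algebra_simps)
  then show "(u' \<longlongrightarrow> 0) at_top" "(u' \<longlongrightarrow> 0) at_bot"
    by (rule tendsto_0_of_powr_le_local_integral[OF int \<open>0 < q\<close>])+
qed

end

section \<open>Instantiating the estimates with the constants of the theorem\<close>

theorem theorem1p1:
  fixes V :: "real \<Rightarrow> real" and E :: complex and u :: "real \<Rightarrow> complex"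
    and C1 C2 C K \<delta> :: real
  assumes V_loc: "locally_integrable V"
    and C1_finite: "bdd_above (range (\<lambda>x. LINT y:{x..x+1}|lebesgue. max (- V y) 0))"
    and C1: "C1 = (SUP x. LINT y:{x..x+1}|lebesgue. max (- V y) 0)"
    and u: "schrodinger_solution V E u"
    and C2: "C2 = C1 + cmod E"
    and C: "C = C2 + 2 * sqrt C2"
    and K: "K = 1 / sqrt C2"
    and \<delta>: "\<delta> = - 1 / 2 + sqrt (1 / 4 + 1 / (2 * C2))"
  shows
    "(C2 > 0 \<longrightarrow>
       (\<forall>x. cmod (vderiv u x) \<le> C * (SUP y\<in>{x - K..x + K}. cmod (u y))) \<and>
       (\<forall>x. u x \<noteq> 0 \<and> Re (cnj (u x) * vderiv u x) \<ge> 0 \<longrightarrow>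
          (\<forall>y\<in>{x..<x + \<delta>}. cmod (u y) > cmod (u x) / 2)) \<and>
       (\<forall>p::real. 1 \<le> p \<longrightarrow> (\<forall>x.
          cmod (u x) powr p \<le>
            2 powr p / \<delta> * (LINT y:{x - \<delta>..x + \<delta>}|lebesgue. cmod (u y) powr p))) \<and>
       (\<forall>p::real. 1 \<le> p \<longrightarrow> (\<forall>x.
          cmod (vderiv u x) powr p \<le>
            2 powr p * C powr p / \<delta> *
              (LINT y:{x - K - \<delta>..x + K + \<delta>}|lebesgue. cmod (u y) powr p))) \<and>
       (\<forall>(p::ennreal) (w :: real \<Rightarrow> real).
          1 \<le> p \<and> w \<in> borel_measurable lebesgue \<and> (\<forall>x. w x > 0) \<and>
          bdd_above {w x / w y | x y. \<bar>x - y\<bar> \<le> K + \<delta>} \<and>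
          u \<in> Lp_space p (density lebesgue (\<lambda>x. ennreal (w x))) \<longrightarrow>
          vderiv u \<in> Lp_space p (density lebesgue (\<lambda>x. ennreal (w x))))) \<and>
     (\<forall>p::ennreal. 1 \<le> p \<and> p < \<infinity> \<and> u \<in> Lp_space p lebesgue \<longrightarrow>
        (u \<longlongrightarrow> 0) at_top \<and> (u \<longlongrightarrow> 0) at_bot \<and>
        (vderiv u \<longlongrightarrow> 0) at_top \<and> (vderiv u \<longlongrightarrow> 0) at_bot)"
proof -
  have C1_upper: "(LINT y:{x..x+1}|lebesgue. max (- V y) 0) \<le> C1" for x
    unfolding C1 by (rule cSUP_upper[OF UNIV_I C1_finite])
  have part6: "(u \<longlongrightarrow> 0) at_top \<and> (u \<longlongrightarrow> 0) at_bot \<and>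
      (vderiv u \<longlongrightarrow> 0) at_top \<and> (vderiv u \<longlongrightarrow> 0) at_bot"
    if "1 \<le> p" "p < \<infinity>" "u \<in> Lp_space p lebesgue" for p
  proof -
    \<comment> \<open>\<open>C2\<close> may vanish here. The limits do not depend on the constants,
      so the larger and positive \<open>max C2 1\<close> is used instead.\<close>
    interpret schrodinger_estimate V E u "vderiv u" "max C2 1"
      by (rule schrodinger_solution_estimate[OF V_loc C1_upper u]) (auto simp: C2)
    show ?thesis using Lp_tendsto_0[OF that] by blast
  qed
  show ?thesis
  proof (intro conjI impI; (intro allI impI)?)
    assume "0 < C2"
    then interpret schrodinger_estimate V E u "vderiv u" C2
      by (intro schrodinger_solution_estimate[OF V_loc C1_upper u]) (auto simp: C2)
    note d = half_length_equation[OF \<open>0 < C2\<close> \<delta>]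
    show "cmod (vderiv u x) \<le> C * (SUP y\<in>{x - K..x + K}. cmod (u y))" for x
      unfolding C
    proof (rule deriv_bound)
      fix y assume "y \<in> {x - 1 / sqrt C2..x + 1 / sqrt C2}"
      \<comment> \<open>Boundedness on the compact interval makes the real supremum a genuine upper
        bound for |u| there.\<close>
      moreover have "bdd_above ((\<lambda>y. cmod (u y)) ` {x - K..x + K})"
        by (intro bounded_imp_bdd_above compact_imp_bounded compact_continuous_image
          continuous_on_norm continuous_u compact_Icc)
      ultimately show "cmod (u y) \<le> (SUP y\<in>{x - K..x + K}. cmod (u y))"
        by (intro cSUP_upper) (auto simp: K)
    qed
    show "\<forall>y\<in>{x..<x + \<delta>}. cmod (u x) / 2 < cmod (u y)"
      if "u x \<noteq> 0 \<and> 0 \<le> Re (cnj (u x) * vderiv u x)" for x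
      using half_lower_bound[OF d] that by blast
    show "cmod (u x) powr p \<le> 2 powr p / \<delta> * (LINT y:{x - \<delta>..x + \<delta>}|lebesgue. cmod (u y) powr p)"
      if "1 \<le> p" for p x
      using that by (intro powr_le_integral[OF d]) simp
    show "cmod (vderiv u x) powr p \<le> 2 powr p * C powr p / \<delta> *
        (LINT y:{x - K - \<delta>..x + K + \<delta>}|lebesgue. cmod (u y) powr p)"
      if "1 \<le> p" for p x
      unfolding C using that by (intro deriv_powr_le_integral[OF d _ K]) simp
    show "vderiv u \<in> Lp_space p (density lebesgue (\<lambda>x. ennreal (w x)))"
      if "1 \<le> p \<and> w \<in> borel_measurable lebesgue \<and> (\<forall>x. w x > 0) \<and>
          bdd_above {w x / w y | x y. \<bar>x - y\<bar> \<le> K + \<delta>} \<and>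
          u \<in> Lp_space p (density lebesgue (\<lambda>x. ennreal (w x)))" for p w
      using that by (intro Lp_density_deriv[OF d K]) auto
  qed (use part6 in auto)
qed

end
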